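(* Let $P$ be a poset with legs and let $n\geq 3$. Then $\mathrm{sat}^*(n,P)\geq n+1$. Moreover, if both $P$ and its dual $\overline P$ have legs, then $\mathrm{sat}^*(n,P)\geq 2n+2$.
   Context: $[n]=\{1,\dots,n\}$. All posets are viewed as finite collections of finite subsets of $\mathbb N$, ordered by inclusion; a poset on $[p]$ is one consisting of subsets of $[p]$. The dual of a poset $P$ on $[p]$ is $\overline P:=\{[p]\setminus F: F\in P\}$. A poset $P$ has legs if there are distinct elements $L_1,L_2,H\in P$ such that $L_1,L_2$ are incomparable, $L_1,L_2\subseteq H$, and every other element $A\in P\setminus\{L_1,L_2,H\}$ satisfies $A\supseteq H$. A poset $P$ is an induced subposet of a poset $Q$ if there is an injective map $\phi:P\to Q$ such that for all $A,B\in P$, $\phi(A)\subseteq\phi(B)$ if and only if $A\subseteq B$; otherwise $Q$ is induced $P$-free. A family $\mathcal F\subseteq 2^{[n]}$ is induced $P$-saturated if $\mathcal F$ is induced $P$-free, but for every $S\subseteq[n]$ with $S\notin\mathcal F$, $P$ is an induced subposet of $\mathcal F\cup\{S\}$. $\mathrm{sat}^*(n,P)$ denotes the size of the smallest induced $P$-saturated family $\mathcal F\subseteq 2^{[n]}$. *)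

theory Defs
  imports Main
begin

text \<open>A poset is a finite family of finite sets of natural numbers, ordered by inclusion,
  and \<open>[n]\<close> is \<open>{1..n}\<close>.\<close>

definition set_poset :: "nat set set \<Rightarrow> bool" where
  "set_poset P \<longleftrightarrow> finite P \<and> (\<forall>A\<in>P. finite A)"

definition poset_on :: "nat \<Rightarrow> nat set set \<Rightarrow> bool" where
  "poset_on p P \<longleftrightarrow> P \<subseteq> Pow {1..p}"

text \<open>The set-theoretic dual depends on the ground set \<open>[p]\<close>; it is only meaningful
  for \<open>P\<close> with \<open>poset_on p P\<close>.\<close>

definition dual_poset :: "nat \<Rightarrow> nat set set \<Rightarrow> nat set set" where
  "dual_poset p P = (\<lambda>F. {1..p} - F) ` P"

definition has_legs :: "nat set set \<Rightarrow> bool" where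
  "has_legs P \<longleftrightarrow>
    (\<exists>L1\<in>P. \<exists>L2\<in>P. \<exists>H\<in>P.
      L1 \<noteq> L2 \<and> L1 \<noteq> H \<and> L2 \<noteq> H \<and>
      \<not> L1 \<subseteq> L2 \<and> \<not> L2 \<subseteq> L1 \<and> L1 \<subseteq> H \<and> L2 \<subseteq> H \<and>
      (\<forall>A\<in>P - {L1, L2, H}. H \<subseteq> A))"

definition induced_subposet :: "nat set set \<Rightarrow> nat set set \<Rightarrow> bool" where
  "induced_subposet P Q \<longleftrightarrow>
    (\<exists>\<phi>. inj_on \<phi> P \<and> \<phi> ` P \<subseteq> Q \<and>
      (\<forall>A\<in>P. \<forall>B\<in>P. \<phi> A \<subseteq> \<phi> B \<longleftrightarrow> A \<subseteq> B))"

definition induced_free :: "nat set set \<Rightarrow> nat set set \<Rightarrow> bool" where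
  "induced_free P Q \<longleftrightarrow> \<not> induced_subposet P Q"

definition induced_saturated :: "nat \<Rightarrow> nat set set \<Rightarrow> nat set set \<Rightarrow> bool" where
  "induced_saturated n P \<F> \<longleftrightarrow>
    \<F> \<subseteq> Pow {1..n} \<and> induced_free P \<F> \<and>
    (\<forall>S. S \<subseteq> {1..n} \<and> S \<notin> \<F> \<longrightarrow> induced_subposet P (\<F> \<union> {S}))"

text \<open>For nonempty \<open>P\<close> the minimum is over a nonempty set
  (lemma \<open>induced_saturated_exists\<close>); for \<open>P = {}\<close> there is no
  saturated family and the value is unspecified.\<close>

definition sat_star :: "nat \<Rightarrow> nat set set \<Rightarrow> nat" where
  "sat_star n P = (LEAST m. \<exists>\<F>. induced_saturated n P \<F> \<and> card \<F> = m)"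

lemma induced_saturated_exists:
  assumes "P \<noteq> {}"
  shows "\<exists>\<F>. induced_saturated n P \<F>"
proof -
  let ?C = "{\<F>. \<F> \<subseteq> Pow {1..n} \<and> induced_free P \<F>}"
  have "finite ?C"
    by (rule finite_subset[of _ "Pow (Pow {1..n})"]) auto
  moreover have "{} \<in> ?C"
    using assms by (auto simp: induced_free_def induced_subposet_def)
  ultimately obtain \<F> where F: "\<F> \<in> ?C" and mx: "\<And>\<G>. \<G> \<in> ?C \<Longrightarrow> \<F> \<subseteq> \<G> \<Longrightarrow> \<F> = \<G>"
    using finite_has_maximal[of ?C] by (metis (no_types, lifting) empty_iff)
  have "induced_subposet P (\<F> \<union> {S})" if "S \<subseteq> {1..n}" "S \<notin> \<F>" for S
    using F that mx[of "\<F> \<union> {S}"] by (auto simp: induced_free_def)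
  with F show ?thesis
    unfolding induced_saturated_def by blast
qed

end

theory Submission
  imports Defs
begin

text \<open>
  Let \<open>\<F>\<close> be induced \<open>P\<close>-saturated and let \<open>\<D>\<close> be the sets of \<open>\<F>\<close> above which \<open>\<F>\<close>
  contains a copy of \<open>P\<close> without its legs. Below a set of \<open>\<D>\<close> the family is a chain, and a set
  \<open>S \<notin> \<F>\<close> below which \<open>\<F>\<close> is a chain can only create a copy of \<open>P\<close> as one of the legs, so
  that \<open>S\<close> lies below some member of \<open>\<D>\<close>. This forces the indicator vectors of the sets in
  \<open>\<D>\<close> and of the singletons in \<open>\<F>\<close> to span the whole \<open>n\<close>-dimensional space: there are at
  least \<open>n\<close> of them, and \<open>\<emptyset> \<in> \<F>\<close> is one more set.

  If the dual has legs too, complementation yields \<open>n + 1\<close> further sets: \<open>\<F>\<close> is a chain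
  above each of them, whereas above a set of \<open>\<D>\<close> it contains the two incomparable maximal
  elements of \<open>P\<close>, and dually; sets with at most one element are not of co-size at most one
  since \<open>n \<ge> 3\<close>.
\<close>

section \<open>Linear algebra over an integral domain and indicator vectors\<close>

text \<open>Gaussian elimination without division: cross-multiplying with the pivot
  \<open>c e k\<close> removes the unknown \<open>k\<close> from the other equations, so one
  equation and one unknown disappear together.\<close>

lemma homogeneous_system_nontrivial_solution:
  fixes c :: "'e \<Rightarrow> 'i \<Rightarrow> 'a::idom"
  assumes "finite E" "finite I" "card E < card I"
  shows "\<exists>w. (\<exists>i\<in>I. w i \<noteq> 0) \<and> (\<forall>e\<in>E. (\<Sum>i\<in>I. c e i * w i) = 0)"
  using assms
proof (induction E arbitrary: I c rule: finite_induct)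
  case empty
  then have "I \<noteq> {}" by auto
  then show ?case by (intro exI[of _ "\<lambda>_. 1"]) auto
next
  case (insert e E)
  show ?case
  proof (cases "\<exists>k\<in>I. c e k \<noteq> 0")
    case False
    moreover obtain w where "\<exists>i\<in>I. w i \<noteq> 0" "\<forall>f\<in>E. (\<Sum>i\<in>I. c f i * w i) = 0"
      using insert.IH[of I c] insert.prems insert.hyps by auto
    ultimately show ?thesis by (intro exI[of _ w]) auto
  next
    case True
    then obtain k where k: "k \<in> I" "c e k \<noteq> 0" by blast
    let ?J = "I - {k}"
    have "card E < card ?J" using insert k by simp
    then obtain w where nz: "\<exists>i\<in>?J. w i \<noteq> 0"
      and w: "\<And>f. f \<in> E \<Longrightarrow> (\<Sum>i\<in>?J. (c e k * c f i - c f k * c e i) * w i) = 0"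
      using insert.IH[of ?J "\<lambda>f i. c e k * c f i - c f k * c e i"] insert.prems by auto
    let ?s = "\<Sum>i\<in>?J. c e i * w i"
    \<comment> \<open>Back-substitution, scaled by the pivot: \<open>k\<close> should get the value
      \<open>- ?s / c e k\<close>, so all values are multiplied by \<open>c e k\<close>.\<close>
    define v where "v i = (if i = k then - ?s else c e k * w i)" for i
    have v: "(\<Sum>i\<in>I. c f i * v i) = (\<Sum>i\<in>?J. (c e k * c f i - c f k * c e i) * w i)" for f
    proof -
      have "(\<Sum>i\<in>I. c f i * v i) = - (c f k * ?s) + (\<Sum>i\<in>?J. c f i * (c e k * w i))"
        using k insert.prems by (simp add: sum.remove[of I k] v_def)
      also have "\<dots> = (\<Sum>i\<in>?J. (c e k * c f i - c f k * c e i) * w i)"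
        by (simp add: sum_distrib_left algebra_simps sum_subtractf)
      finally show ?thesis .
    qed
    have "\<exists>i\<in>I. v i \<noteq> 0" using nz k by (auto simp: v_def)
    \<comment> \<open>For \<open>f = e\<close> the coefficients in \<open>v\<close> cancel one by
      one; the other \<open>f\<close> are the reduced equations solved by \<open>w\<close>.\<close>
    moreover have "(\<Sum>i\<in>I. c f i * v i) = 0" if "f \<in> insert e E" for f
      using that w[of f] by (auto simp: v)
    ultimately show ?thesis by blast
  qed
qed

text \<open>Fewer than \<open>card N\<close> indicator vectors cannot span, so some nonzero integer
  vector is orthogonal to all of them.\<close>

lemma nontrivial_weight_vanishing_on_sets:
  assumes "finite N" "\<A> \<subseteq> Pow N" "card \<A> < card N"
  shows "\<exists>w :: 'i \<Rightarrow> int. (\<exists>i\<in>N. w i \<noteq> 0) \<and> (\<forall>A\<in>\<A>. sum w A = 0)"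
proof -
  have "finite \<A>" using assms finite_subset by blast
  then obtain w :: "'i \<Rightarrow> int" where "\<exists>i\<in>N. w i \<noteq> 0"
    and w: "\<And>A. A \<in> \<A> \<Longrightarrow> (\<Sum>i\<in>N. of_bool (i \<in> A) * w i) = 0"
    using homogeneous_system_nontrivial_solution[of \<A> N "\<lambda>A i. of_bool (i \<in> A)"] assms by blast
  moreover have "sum w A = (\<Sum>i\<in>N. of_bool (i \<in> A) * w i)" if "A \<in> \<A>" for A
  proof -
    have "A \<subseteq> N" using that assms by auto
    then show ?thesis using \<open>finite N\<close> by (intro sum.mono_neutral_cong_left) auto
  qed
  ultimately show ?thesis by auto
qed

section \<open>The linear bound for families that are chains below \<open>\<D>\<close>\<close>

text \<open>Take \<open>Y\<close> minimal in \<open>\<F>\<close> between \<open>p\<close> and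
  \<open>H\<close>, then \<open>X\<close> maximal in \<open>\<F>\<close> strictly below
  \<open>Y\<close>. Minimality of \<open>Y\<close> keeps \<open>p\<close> from fitting into
  \<open>X\<close>; \<open>X\<close> exists because \<open>{}\<close> lies strictly below
  \<open>Y\<close>.\<close>

lemma consecutive_pair_exists:
  assumes "finite \<F>" "{} \<in> \<F>" "H \<in> \<F>" "finite H" "p \<subseteq> H" "p \<noteq> {}"
  obtains X Y where "X \<in> \<F>" "Y \<in> \<F>" "X \<subset> Y" "p \<subseteq> Y" "Y \<subseteq> H" "\<not> p \<subseteq> X"
    "\<And>Z. Z \<in> \<F> \<Longrightarrow> X \<subset> Z \<Longrightarrow> \<not> Z \<subset> Y"
proof -
  let ?U = "{Z \<in> \<F>. p \<subseteq> Z \<and> Z \<subseteq> H}"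
  have "finite ?U" "?U \<noteq> {}" using assms by auto
  from finite_has_minimal[OF this] obtain Y
    where Y: "Y \<in> ?U" and Ymin: "\<And>Z. Z \<in> ?U \<Longrightarrow> Z \<subseteq> Y \<Longrightarrow> Y = Z" by meson
  let ?V = "{Z \<in> \<F>. Z \<subset> Y}"
  have "{} \<in> ?V" using assms Y by auto
  then have "finite ?V" "?V \<noteq> {}" using assms by auto
  from finite_has_maximal[OF this] obtain X
    where X: "X \<in> ?V" and Xmax: "\<And>Z. Z \<in> ?V \<Longrightarrow> X \<subseteq> Z \<Longrightarrow> X = Z" by meson
  have "\<not> p \<subseteq> X" using X Y Ymin[of X] by blast
  moreover have "\<not> Z \<subset> Y" if "Z \<in> \<F>" "X \<subset> Z" for Z using that Xmax[of Z] by blast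
  ultimately show thesis using that[of X Y] X Y by blast
qed

text \<open>\<open>P\<close> is gone here: \<open>chain\<close>, \<open>down\<close> and
  \<open>cover\<close> are all that saturation contributes. With too few sets some nonzero weight
  \<open>w\<close> sums to zero on each of them, and following its positive elements upwards never
  ends.\<close>

lemma card_lower_family:
  assumes N: "finite N" "\<F> \<subseteq> Pow N"
    and D: "\<D> \<subseteq> \<F>"
    and chain: "\<And>Y. Y \<in> \<D> \<Longrightarrow> chain_subset {A \<in> \<F>. A \<subseteq> Y}"
    and down: "\<And>A Y. A \<in> \<F> \<Longrightarrow> Y \<in> \<D> \<Longrightarrow> A \<subseteq> Y \<Longrightarrow> A \<in> \<D>"
    and cover: "\<And>S. S \<subseteq> N \<Longrightarrow> S \<notin> \<F> \<Longrightarrow> chain_subset {A \<in> \<F>. A \<subseteq> S} \<Longrightarrow>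
      \<exists>L\<in>\<F>. \<exists>H\<in>\<D>. \<not> L \<subseteq> S \<and> \<not> S \<subseteq> L \<and> L \<subseteq> H \<and> S \<subseteq> H"
  shows "card N + 1 \<le> card {A \<in> \<F>. card A \<le> 1 \<or> A \<in> \<D>}"
proof (rule ccontr)
  let ?L = "{A \<in> \<F>. card A \<le> 1 \<or> A \<in> \<D>}"
  assume "\<not> card N + 1 \<le> card ?L"
  have finF: "finite \<F>" using N finite_subset by blast
  have fin: "finite A" if "A \<in> \<F>" for A using that N finite_subset by blast
  have comp: "A \<subseteq> B \<or> B \<subseteq> A" if "Y \<in> \<D>" "A \<in> \<F>" "B \<in> \<F>" "A \<subseteq> Y" "B \<subseteq> Y" for A B Y
    using chain[of Y] that by (auto simp: chain_subset_def)
  \<comment> \<open>Every \<open>L\<close> contains \<open>{}\<close>, so the conclusion of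
    \<open>cover\<close> fails for \<open>S = {}\<close>.\<close>
  have emp: "{} \<in> \<F>"
    using cover[of "{}"] by (auto simp: chain_subset_def)
  then have "{} \<in> ?L" by simp
  \<comment> \<open>The empty set puts no condition on a weight; dropping it makes the number of
    equations strictly smaller than the number of unknowns.\<close>
  then have "card (?L - {{}}) < card N"
    using \<open>\<not> card N + 1 \<le> card ?L\<close> finF card_Diff1_less[of ?L "{}"] by fastforce
  moreover have "?L - {{}} \<subseteq> Pow N" using N by auto
  ultimately obtain w :: "'a \<Rightarrow> int" where nz: "\<exists>i\<in>N. w i \<noteq> 0"
    and w': "\<forall>A\<in>?L - {{}}. sum w A = 0"
    using nontrivial_weight_vanishing_on_sets[OF N(1), of "?L - {{}}"] by (elim exE conjE meta_impE)
  have w: "sum w A = 0" if "A \<in> ?L" for A using w' that by (cases "A = {}") auto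
  define pos where "pos Y = {i \<in> Y. w i > 0}" for Y
  \<comment> \<open>Sets strictly between consecutive members are missing from \<open>\<F>\<close>;
    a positive element of \<open>Y - X\<close> allows building such a set, to which
    \<open>cover\<close> applies.\<close>
  define gap where "gap = (\<lambda>(X, Y). X \<in> \<F> \<and> Y \<in> \<D> \<and> X \<subset> Y \<and> pos Y - X \<noteq> {} \<and>
    (\<forall>Z\<in>\<F>. X \<subset> Z \<longrightarrow> \<not> Z \<subset> Y))"
  have gap_below: "\<exists>X Y. gap (X, Y) \<and> Y \<subseteq> H \<and> pos H \<subseteq> Y" if HD: "H \<in> \<D>" and ne: "pos H \<noteq> {}" for H
  proof -
    have H: "H \<in> \<F>" "finite H" "pos H \<subseteq> H" using HD D fin by (auto simp: pos_def)
    obtain X Y where XY: "X \<in> \<F>" "Y \<in> \<F>" "X \<subset> Y" "pos H \<subseteq> Y" "Y \<subseteq> H" "\<not> pos H \<subseteq> X"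
      "\<And>Z. Z \<in> \<F> \<Longrightarrow> X \<subset> Z \<Longrightarrow> \<not> Z \<subset> Y"
      using consecutive_pair_exists[OF finF emp H ne] by blast
    moreover have "Y \<in> \<D>" using down XY HD by blast
    moreover have "pos H = pos Y" using XY by (auto simp: pos_def)
    ultimately show ?thesis unfolding gap_def by (intro exI[of _ X] exI[of _ Y]) auto
  qed
  have "\<exists>t. gap t"
  proof -
    \<comment> \<open>Singletons in \<open>\<F>\<close> have weight zero, so \<open>{i}\<close> is
      missing and gets covered by some \<open>H\<close>. As \<open>H\<close> has total weight zero
      but contains \<open>i\<close>, it also has an element of positive weight.\<close>
    obtain i where i: "i \<in> N" "w i \<noteq> 0" using nz by blast
    have "{i} \<notin> \<F>" using w[of "{i}"] i by auto
    moreover from this have "chain_subset {A \<in> \<F>. A \<subseteq> {i}}"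
      by (auto simp: chain_subset_def subset_singleton_iff)
    ultimately obtain H where H: "H \<in> \<D>" "i \<in> H" using cover[of "{i}"] i by auto
    then have "finite H" "sum w H = 0" using fin w[of H] D by auto
    have "pos H \<noteq> {}"
    proof
      assume "pos H = {}"
      then have "\<forall>j\<in>H. - w j \<ge> 0" by (auto simp: pos_def not_less)
      then have "\<forall>j\<in>H. - w j = 0"
        using sum_nonneg_eq_0_iff[of H "\<lambda>j. - w j"] \<open>finite H\<close> \<open>sum w H = 0\<close>
        by (simp add: sum_negf)
      then show False using H i by auto
    qed
    then show ?thesis using gap_below[OF H(1)] by blast
  qed
  \<comment> \<open>A gap of maximal \<open>m\<close> is contradictory: adding the positive elements of \<open>Y\<close> to \<open>X\<close>
    gives a set outside \<open>\<F>\<close> whose cover \<open>H\<close> contains a gap with larger \<open>m\<close>.\<close>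
  define m where "m = (\<lambda>(X :: 'a set, Y). card (pos Y) + card X)"
  have "m t < 2 * card N + 1" if "gap t" for t
  proof -
    obtain X Y where t: "t = (X, Y)" by fastforce
    have "X \<subseteq> N" "pos Y \<subseteq> N" using that D N by (auto simp: t gap_def pos_def)
    then have "card X \<le> card N" "card (pos Y) \<le> card N" using card_mono[OF N(1)] by blast+
    then show ?thesis by (simp add: t m_def)
  qed
  then obtain t where t: "gap t" and max: "\<And>u. gap u \<Longrightarrow> m u \<le> m t"
    using \<open>\<exists>t. gap t\<close> ex_has_greatest_nat[of gap _ m "2 * card N + 1"] by blast
  obtain X Y where XY: "t = (X, Y)" by fastforce
  have X: "X \<in> \<F>" and Y: "Y \<in> \<D>" "Y \<in> \<F>" and "X \<subset> Y" and p: "pos Y - X \<noteq> {}"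
    and consec: "\<And>Z. Z \<in> \<F> \<Longrightarrow> X \<subset> Z \<Longrightarrow> \<not> Z \<subset> Y"
    using t D by (auto simp: XY gap_def)
  define S where "S = X \<union> pos Y"
  have "X \<subset> S" "S \<subseteq> Y" using p \<open>X \<subset> Y\<close> by (auto simp: S_def pos_def)
  have "S \<noteq> Y"
  proof
    \<comment> \<open>The weights sum to \<open>0\<close> over \<open>Y - X\<close>, so they cannot all be positive.\<close>
    assume "S = Y"
    have "sum w (Y - X) = sum w Y - sum w X"
      using fin Y \<open>X \<subset> Y\<close> by (intro sum_diff) auto
    also have "\<dots> = 0" using w[of X] w[of Y] X Y down[of X Y] \<open>X \<subset> Y\<close> by auto
    finally have "sum w (Y - X) = 0" .
    moreover have "sum w (Y - X) > 0"
      using \<open>S = Y\<close> fin Y \<open>X \<subset> Y\<close> by (intro sum_pos) (auto simp: S_def pos_def)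
    ultimately show False by simp
  qed
  have "S \<subseteq> N" using \<open>S \<subseteq> Y\<close> Y N by auto
  moreover have "S \<notin> \<F>" using consec[of S] \<open>X \<subset> S\<close> \<open>S \<subseteq> Y\<close> \<open>S \<noteq> Y\<close> by auto
  moreover have "chain_subset {A \<in> \<F>. A \<subseteq> S}"
    using chain[OF Y(1)] \<open>S \<subseteq> Y\<close> by (auto simp: chain_subset_def)
  ultimately have "\<exists>L\<in>\<F>. \<exists>H\<in>\<D>. \<not> L \<subseteq> S \<and> \<not> S \<subseteq> L \<and> L \<subseteq> H \<and> S \<subseteq> H"
    by (rule cover)
  then obtain L H where L: "L \<in> \<F>" and H: "H \<in> \<D>"
    and LS: "\<not> L \<subseteq> S" "\<not> S \<subseteq> L" and LH: "L \<subseteq> H" and SH: "S \<subseteq> H"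
    by (elim bexE conjE) (rule that)
  \<comment> \<open>Both lie below \<open>H\<close>, hence are comparable, and
    \<open>L \<subseteq> X\<close> would give \<open>L \<subseteq> S\<close>.\<close>
  have "X \<subset> L" using comp[OF H X L] LS LH SH \<open>X \<subset> S\<close> by blast
  have "pos Y \<subseteq> pos H" using SH by (auto simp: S_def pos_def)
  with p have "pos H \<noteq> {}" by blast
  then obtain X' Y' where g: "gap (X', Y')" and "Y' \<subseteq> H" "pos H \<subseteq> Y'"
    using gap_below H by blast
  have X': "X' \<in> \<F>" and Y': "Y' \<in> \<D>" "Y' \<in> \<F>" and "X' \<subset> Y'"
    and consec': "\<And>Z. Z \<in> \<F> \<Longrightarrow> X' \<subset> Z \<Longrightarrow> \<not> Z \<subset> Y'"
    using g D by (auto simp: gap_def)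
  \<comment> \<open>Otherwise \<open>L\<close> would contain \<open>X\<close> and
    \<open>pos Y\<close>, that is, all of \<open>S\<close>.\<close>
  have "\<not> Y' \<subseteq> L"
    using LS \<open>pos H \<subseteq> Y'\<close> \<open>pos Y \<subseteq> pos H\<close> \<open>X \<subset> L\<close> by (auto simp: S_def)
  then have "L \<subset> Y'" using comp[OF H L Y'(2) LH \<open>Y' \<subseteq> H\<close>] by blast
  \<comment> \<open>\<open>L\<close> is comparable with \<open>X'\<close> and cannot lie strictly
    between \<open>X'\<close> and \<open>Y'\<close>. Hence
    \<open>X \<subset> L \<subseteq> X'\<close>, and the new gap has a larger lower set.\<close>
  then have "L \<subseteq> X'" using comp[OF Y'(1) L X'] consec'[OF L] \<open>X' \<subset> Y'\<close> by blast
  then have "card X < card X'" using \<open>X \<subset> L\<close> fin[OF X'] by (intro psubset_card_mono) auto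
  moreover have "card (pos Y) \<le> card (pos Y')"
    using \<open>pos Y \<subseteq> pos H\<close> \<open>pos H \<subseteq> Y'\<close> fin[OF Y'(2)]
    by (intro card_mono) (auto simp: pos_def)
  ultimately show False using max[OF g] by (simp add: XY m_def)
qed

section \<open>Legs and induced copies of the poset\<close>

text \<open>The witnesses are named, and the last clause ranges over \<open>H\<close> too, so that
  \<open>H\<close> is the least element of \<open>P - {L1, L2}\<close>, the poset without its
  legs.\<close>

definition legs :: "nat set set \<Rightarrow> nat set \<Rightarrow> nat set \<Rightarrow> nat set \<Rightarrow> bool" where
  "legs P L1 L2 H \<longleftrightarrow> L1 \<in> P \<and> L2 \<in> P \<and> H \<in> P - {L1, L2} \<and>
    \<not> L1 \<subseteq> L2 \<and> \<not> L2 \<subseteq> L1 \<and> L1 \<subseteq> H \<and> L2 \<subseteq> H \<and> (\<forall>A\<in>P - {L1, L2}. H \<subseteq> A)"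

lemma has_legs_iff: "has_legs P \<longleftrightarrow> (\<exists>L1 L2 H. legs P L1 L2 H)"
proof
  assume "has_legs P"
  then obtain L1 L2 H where "L1 \<in> P" "L2 \<in> P" "H \<in> P" "L1 \<noteq> H" "L2 \<noteq> H"
    "\<not> L1 \<subseteq> L2" "\<not> L2 \<subseteq> L1" "L1 \<subseteq> H" "L2 \<subseteq> H" "\<forall>A\<in>P - {L1, L2, H}. H \<subseteq> A"
    unfolding has_legs_def by (elim bexE conjE) (rule that)
  then have "legs P L1 L2 H" by (auto simp: legs_def)
  then show "\<exists>L1 L2 H. legs P L1 L2 H" by blast
next
  assume "\<exists>L1 L2 H. legs P L1 L2 H"
  then obtain L1 L2 H where l: "legs P L1 L2 H" by blast
  show "has_legs P" unfolding has_legs_def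
    using l by (intro bexI[of _ L1] bexI[of _ L2] bexI[of _ H]) (auto simp: legs_def)
qed

lemma induced_subposetI:
  assumes "\<And>A. A \<in> P \<Longrightarrow> \<phi> A \<in> Q"
    and "\<And>A B. A \<in> P \<Longrightarrow> B \<in> P \<Longrightarrow> \<phi> A \<subseteq> \<phi> B \<longleftrightarrow> A \<subseteq> B"
  shows "induced_subposet P Q"
proof -
  have "inj_on \<phi> P" using assms(2) by (metis inj_onI order_antisym order_refl)
  then show ?thesis unfolding induced_subposet_def using assms by blast
qed

lemma induced_subposetE:
  assumes "induced_subposet P Q"
  obtains \<phi> where "inj_on \<phi> P" "\<And>A. A \<in> P \<Longrightarrow> \<phi> A \<in> Q"
    "\<And>A B. A \<in> P \<Longrightarrow> B \<in> P \<Longrightarrow> \<phi> A \<subseteq> \<phi> B \<longleftrightarrow> A \<subseteq> B"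
proof -
  obtain \<phi> where "inj_on \<phi> P" "\<phi> ` P \<subseteq> Q" "\<forall>A\<in>P. \<forall>B\<in>P. \<phi> A \<subseteq> \<phi> B \<longleftrightarrow> A \<subseteq> B"
    using assms unfolding induced_subposet_def by (elim exE conjE) (rule that)
  then show thesis by (intro that[of \<phi>]) (simp_all add: image_subset_iff)
qed

text \<open>Incomparable sets below \<open>Y\<close> complete a legless copy above \<open>Y\<close>
  to a copy of \<open>P\<close>. In a \<open>P\<close>-free family this forces a chain below
  \<open>Y\<close>.\<close>

lemma attach_legs:
  assumes l: "legs P L1 L2 H"
    and Q: "induced_subposet (P - {L1, L2}) {B \<in> \<F>. Y \<subseteq> B}"
    and A: "A \<in> \<F>" "A \<subseteq> Y" and B: "B \<in> \<F>" "B \<subseteq> Y" and AB: "\<not> A \<subseteq> B" "\<not> B \<subseteq> A"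
  shows "induced_subposet P \<F>"
proof -
  obtain \<phi> where \<phi>: "\<And>C. C \<in> P - {L1, L2} \<Longrightarrow> \<phi> C \<in> {B \<in> \<F>. Y \<subseteq> B}"
    "\<And>C D. C \<in> P - {L1, L2} \<Longrightarrow> D \<in> P - {L1, L2} \<Longrightarrow> \<phi> C \<subseteq> \<phi> D \<longleftrightarrow> C \<subseteq> D"
    using Q by (rule induced_subposetE) blast
  define \<psi> where "\<psi> = \<phi>(L1 := A, L2 := B)"
  have ne: "L1 \<noteq> L2" using l by (auto simp: legs_def)
  then have \<psi>: "\<psi> L1 = A" "\<psi> L2 = B" "\<And>C. C \<in> P - {L1, L2} \<Longrightarrow> \<psi> C = \<phi> C"
    by (auto simp: \<psi>_def)
  have above: "A \<subseteq> \<phi> C" "B \<subseteq> \<phi> C" "\<not> \<phi> C \<subseteq> A" "\<not> \<phi> C \<subseteq> B"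
    "L1 \<subseteq> C" "L2 \<subseteq> C" "\<not> C \<subseteq> L1" "\<not> C \<subseteq> L2" if "C \<in> P - {L1, L2}" for C
  proof -
    have "Y \<subseteq> \<phi> C" using \<phi>(1)[OF that] by blast
    \<comment> \<open>If \<open>\<phi> C \<subseteq> A\<close>, then
      \<open>B \<subseteq> Y \<subseteq> \<phi> C \<subseteq> A\<close>, against incomparability;
      likewise for \<open>B\<close>.\<close>
    then show "A \<subseteq> \<phi> C" "B \<subseteq> \<phi> C" "\<not> \<phi> C \<subseteq> A" "\<not> \<phi> C \<subseteq> B" using A B AB by blast+
    have "H \<subseteq> C" using that l by (auto simp: legs_def)
    moreover have "L1 \<subseteq> H" "L2 \<subseteq> H" "\<not> L1 \<subseteq> L2" "\<not> L2 \<subseteq> L1" using l by (auto simp: legs_def)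
    ultimately show "L1 \<subseteq> C" "L2 \<subseteq> C" "\<not> C \<subseteq> L1" "\<not> C \<subseteq> L2" by blast+
  qed
  have L: "\<not> L1 \<subseteq> L2" "\<not> L2 \<subseteq> L1" using l by (auto simp: legs_def)
  have cases: "C = L1 \<or> C = L2 \<or> C \<in> P - {L1, L2}" if "C \<in> P" for C using that by blast
  show ?thesis
  proof (rule induced_subposetI[of _ \<psi>])
    show "\<psi> C \<in> \<F>" if "C \<in> P" for C
      using cases[OF that] by (elim disjE) (use \<psi> A B \<phi>(1)[of C] in simp_all)
    show "\<psi> C \<subseteq> \<psi> D \<longleftrightarrow> C \<subseteq> D" if "C \<in> P" "D \<in> P" for C D
      using cases[OF that(1)] cases[OF that(2)]
    proof (elim disjE)
      assume "C \<in> P - {L1, L2}" "D \<in> P - {L1, L2}"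
      then show ?thesis using \<psi>(3) \<phi>(2) by simp
    qed (use \<psi> above AB L in simp_all)
  qed
qed

text \<open>The new copy has to use \<open>S\<close>. If \<open>S\<close> were not the image of a
  leg, the images of both legs would be incomparable members of \<open>\<F>\<close> below
  \<open>S\<close>. So \<open>S\<close> is one leg, \<open>L\<close> the other, and \<open>K\<close>
  the image of \<open>H\<close>.\<close>

lemma new_set_is_leg:
  assumes l: "legs P L1 L2 H"
    and ind: "induced_subposet P (\<F> \<union> {S})" and free: "\<not> induced_subposet P \<F>"
    and chain: "chain_subset {A \<in> \<F>. A \<subseteq> S}"
  shows "\<exists>L\<in>\<F>. \<exists>K\<in>\<F>. \<not> L \<subseteq> S \<and> \<not> S \<subseteq> L \<and> L \<subseteq> K \<and> S \<subseteq> K \<and>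
    induced_subposet (P - {L1, L2}) {B \<in> \<F>. K \<subseteq> B}"
proof -
  obtain \<phi> where inj: "inj_on \<phi> P" and in_FS: "\<And>A. A \<in> P \<Longrightarrow> \<phi> A \<in> \<F> \<union> {S}"
    and mono: "\<And>A B. A \<in> P \<Longrightarrow> B \<in> P \<Longrightarrow> \<phi> A \<subseteq> \<phi> B \<longleftrightarrow> A \<subseteq> B"
    using ind by (rule induced_subposetE) blast
  have lP: "L1 \<in> P" "L2 \<in> P" "H \<in> P" "H \<noteq> L1" "H \<noteq> L2" and L12: "\<not> L1 \<subseteq> L2" "\<not> L2 \<subseteq> L1"
    and LH: "L1 \<subseteq> H" "L2 \<subseteq> H" and above: "\<And>A. A \<in> P - {L1, L2} \<Longrightarrow> H \<subseteq> A"
    using l by (auto simp: legs_def)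
  obtain C where C: "C \<in> P" "\<phi> C = S"
    using free in_FS mono induced_subposetI[of P \<phi> \<F>] by blast
  have in_F: "\<phi> A \<in> \<F>" if "A \<in> P" "A \<noteq> C" for A
    using in_FS[OF that(1)] inj that C by (auto dest: inj_onD)
  have "C = L1 \<or> C = L2"
  proof (rule ccontr)
    assume c: "\<not> (C = L1 \<or> C = L2)"
    then have "H \<subseteq> C" using above C by blast
    then have "\<phi> L1 \<subseteq> S" "\<phi> L2 \<subseteq> S" using mono C lP LH by blast+
    moreover have "\<phi> L1 \<in> \<F>" "\<phi> L2 \<in> \<F>" using in_F lP c by auto
    ultimately have "\<phi> L1 \<subseteq> \<phi> L2 \<or> \<phi> L2 \<subseteq> \<phi> L1" using chain by (auto simp: chain_subset_def)
    then show False using mono lP L12 by blast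
  qed
  then obtain L where L: "L \<in> P" "L \<noteq> C" "\<not> L \<subseteq> C" "\<not> C \<subseteq> L" "L \<subseteq> H" "C \<subseteq> H"
    using lP L12 LH by blast
  have "induced_subposet (P - {L1, L2}) {B \<in> \<F>. \<phi> H \<subseteq> B}"
    using mono in_F above lP \<open>C = L1 \<or> C = L2\<close> by (intro induced_subposetI[of _ \<phi>]) auto
  moreover have "\<phi> L \<in> \<F>" "\<phi> H \<in> \<F>" using in_F L lP \<open>C = L1 \<or> C = L2\<close> by auto
  moreover have "\<not> \<phi> L \<subseteq> S" "\<not> S \<subseteq> \<phi> L" "\<phi> L \<subseteq> \<phi> H" "S \<subseteq> \<phi> H"
    using mono C L lP by blast+
  ultimately show ?thesis by blast
qed

lemma induced_subposet_mono:
  "induced_subposet P Q \<Longrightarrow> Q \<subseteq> R \<Longrightarrow> induced_subposet P R"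
  unfolding induced_subposet_def by (elim exE conjE, intro exI conjI, assumption) auto

text \<open>Instantiates the linear bound: \<open>attach_legs\<close> yields \<open>chain\<close>,
  \<open>new_set_is_leg\<close> yields \<open>cover\<close>, and \<open>down\<close> holds since
  more sets lie above a smaller set. Sets with at most one element have a chain below them
  anyway.\<close>

lemma saturated_lower_family:
  assumes sat: "induced_saturated n P \<F>" and l: "legs P L1 L2 H"
  obtains \<L> where "\<L> \<subseteq> \<F>" "n + 1 \<le> card \<L>"
    "\<And>A. A \<in> \<L> \<Longrightarrow> chain_subset {B \<in> \<F>. B \<subseteq> A}"
    "\<And>A. A \<in> \<L> \<Longrightarrow> card A \<le> 1 \<or> induced_subposet (P - {L1, L2}) {B \<in> \<F>. A \<subseteq> B}"
proof -
  have F: "\<F> \<subseteq> Pow {1..n}" and free: "\<not> induced_subposet P \<F>"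
    and ind: "\<And>S. S \<subseteq> {1..n} \<Longrightarrow> S \<notin> \<F> \<Longrightarrow> induced_subposet P (\<F> \<union> {S})"
    using sat by (auto simp: induced_saturated_def induced_free_def)
  define \<D> where "\<D> = {A \<in> \<F>. induced_subposet (P - {L1, L2}) {B \<in> \<F>. A \<subseteq> B}}"
  have chain: "chain_subset {B \<in> \<F>. B \<subseteq> A}" if "A \<in> \<D>" for A
    unfolding chain_subset_def
    using attach_legs[OF l, of \<F> A] that free by (auto simp: \<D>_def)
  have down: "A \<in> \<D>" if "A \<in> \<F>" "Y \<in> \<D>" "A \<subseteq> Y" for A Y
    using that induced_subposet_mono[of _ "{B \<in> \<F>. Y \<subseteq> B}" "{B \<in> \<F>. A \<subseteq> B}"]
    by (auto simp: \<D>_def)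
  have cover: "\<exists>L\<in>\<F>. \<exists>H\<in>\<D>. \<not> L \<subseteq> S \<and> \<not> S \<subseteq> L \<and> L \<subseteq> H \<and> S \<subseteq> H"
    if "S \<subseteq> {1..n}" "S \<notin> \<F>" "chain_subset {A \<in> \<F>. A \<subseteq> S}" for S
    using new_set_is_leg[OF l ind[OF that(1,2)] free that(3)] unfolding \<D>_def by blast
  let ?L = "{A \<in> \<F>. card A \<le> 1 \<or> A \<in> \<D>}"
  have "card {1..n} + 1 \<le> card ?L"
    by (rule card_lower_family) (use F chain down cover in \<open>auto simp: \<D>_def\<close>)
  moreover have "chain_subset {B \<in> \<F>. B \<subseteq> A}" if "A \<in> ?L" for A
  proof (cases "A \<in> \<D>")
    case False
    then have "card A \<le> 1" "A \<subseteq> {1..n}" using that F by auto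
    then have "card A \<le> 1" "finite A" by (auto intro: finite_subset)
    then obtain x where "A \<subseteq> {x}"
      by (metis card_1_singletonE card_eq_0_iff empty_subsetI le_less less_one order_refl)
    then show ?thesis by (auto simp: chain_subset_def subset_singleton_iff)
  qed (use chain in auto)
  ultimately show thesis using that[of ?L] by (auto simp: \<D>_def)
qed

section \<open>Complementation and the dual poset\<close>

lemma dual_dual:
  assumes "poset_on p P"
  shows "dual_poset p (dual_poset p P) = P"
proof -
  have "{1..p} - ({1..p} - F) = F" if "F \<in> P" for F
    using that assms by (auto simp: poset_on_def)
  then show ?thesis by (simp add: dual_poset_def image_image)
qed

lemma poset_on_dual: "poset_on p (dual_poset p P)"
  by (auto simp: poset_on_def dual_poset_def)

lemma mem_dual_iff: "poset_on p P \<Longrightarrow> A \<subseteq> {1..p} \<Longrightarrow> A \<in> dual_poset p P \<longleftrightarrow> {1..p} - A \<in> P"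
  by (auto simp: poset_on_def dual_poset_def double_diff)

text \<open>The embedding is conjugated by the complements in the two ground sets; inclusion is
  reversed twice.\<close>

lemma induced_subposet_dual:
  assumes "poset_on p P" "poset_on q Q" "induced_subposet P Q"
  shows "induced_subposet (dual_poset p P) (dual_poset q Q)"
proof -
  obtain \<phi> where \<phi>: "\<And>A. A \<in> P \<Longrightarrow> \<phi> A \<in> Q"
    "\<And>A B. A \<in> P \<Longrightarrow> B \<in> P \<Longrightarrow> \<phi> A \<subseteq> \<phi> B \<longleftrightarrow> A \<subseteq> B"
    using assms(3) by (rule induced_subposetE) blast
  have mem: "{1..p} - A \<in> P" "A \<subseteq> {1..p}" if "A \<in> dual_poset p P" for A
    using that assms(1) by (auto simp: dual_poset_def poset_on_def double_diff)
  show ?thesis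
  proof (rule induced_subposetI[of _ "\<lambda>A. {1..q} - \<phi> ({1..p} - A)"])
    show "{1..q} - \<phi> ({1..p} - A) \<in> dual_poset q Q" if "A \<in> dual_poset p P" for A
      using mem that \<phi>(1) by (auto simp: dual_poset_def)
    show "{1..q} - \<phi> ({1..p} - A) \<subseteq> {1..q} - \<phi> ({1..p} - B) \<longleftrightarrow> A \<subseteq> B"
      if "A \<in> dual_poset p P" "B \<in> dual_poset p P" for A B
    proof -
      have "\<phi> ({1..p} - A) \<subseteq> {1..q}" "\<phi> ({1..p} - B) \<subseteq> {1..q}"
        using \<phi>(1)[OF mem(1)] that assms(2) by (auto simp: poset_on_def)
      then have "{1..q} - \<phi> ({1..p} - A) \<subseteq> {1..q} - \<phi> ({1..p} - B) \<longleftrightarrow>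
          \<phi> ({1..p} - B) \<subseteq> \<phi> ({1..p} - A)" by blast
      also have "\<dots> \<longleftrightarrow> {1..p} - B \<subseteq> {1..p} - A" using \<phi>(2) mem(1) that by blast
      also have "\<dots> \<longleftrightarrow> A \<subseteq> B" using mem(2) that by blast
      finally show ?thesis .
    qed
  qed
qed

lemma induced_subposet_dual_iff:
  assumes "poset_on p P" "poset_on q Q"
  shows "induced_subposet (dual_poset p P) (dual_poset q Q) \<longleftrightarrow> induced_subposet P Q"
  using induced_subposet_dual[OF assms]
    induced_subposet_dual[OF poset_on_dual poset_on_dual, of p P q Q]
  by (auto simp: dual_dual assms)

text \<open>A set missing from the dual family is the complement of one missing from
  \<open>\<F>\<close>, and the copy that the latter creates dualizes.\<close>

lemma induced_saturated_dual:
  assumes "poset_on p P" "induced_saturated n P \<F>"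
  shows "induced_saturated n (dual_poset p P) (dual_poset n \<F>)"
proof -
  have F: "poset_on n \<F>" and free: "\<not> induced_subposet P \<F>"
    and ind: "\<And>S. S \<subseteq> {1..n} \<Longrightarrow> S \<notin> \<F> \<Longrightarrow> induced_subposet P (\<F> \<union> {S})"
    using assms(2) by (auto simp: induced_saturated_def induced_free_def poset_on_def)
  have "induced_subposet (dual_poset p P) (dual_poset n \<F> \<union> {S})"
    if S: "S \<subseteq> {1..n}" "S \<notin> dual_poset n \<F>" for S
  proof -
    let ?T = "{1..n} - S"
    have "induced_subposet P (\<F> \<union> {?T})"
      using S by (intro ind) (auto simp: mem_dual_iff[OF F])
    moreover have "poset_on n (\<F> \<union> {?T})" using F by (auto simp: poset_on_def)
    ultimately have "induced_subposet (dual_poset p P) (dual_poset n (\<F> \<union> {?T}))"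
      using induced_subposet_dual assms(1) by blast
    also have "dual_poset n (\<F> \<union> {?T}) = dual_poset n \<F> \<union> {S}"
      using S by (auto simp: dual_poset_def double_diff)
    finally show ?thesis .
  qed
  moreover have "\<not> induced_subposet (dual_poset p P) (dual_poset n \<F>)"
    using free induced_subposet_dual_iff[OF assms(1) F] by simp
  ultimately show ?thesis
    using poset_on_dual[of n \<F>] by (auto simp: induced_saturated_def induced_free_def poset_on_def)
qed

section \<open>Posets with legs at both ends\<close>

text \<open>Complements of the dual legs are incomparable elements \<open>T1\<close>,
  \<open>T2\<close> at the top of \<open>P\<close>; they lie above \<open>H\<close>, so they survive
  the removal of \<open>L1\<close> and \<open>L2\<close>.\<close>

lemma not_chain_without_legs:
  assumes P: "poset_on p P" and l: "legs P L1 L2 H" and dual: "has_legs (dual_poset p P)"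
  shows "\<not> chain_subset (P - {L1, L2})"
proof -
  obtain U1 U2 K where d: "legs (dual_poset p P) U1 U2 K"
    using dual by (auto simp: has_legs_iff)
  define T1 T2 G where "T1 = {1..p} - U1" and "T2 = {1..p} - U2" and "G = {1..p} - K"
  have U: "U1 \<subseteq> {1..p}" "U2 \<subseteq> {1..p}" "K \<subseteq> {1..p}"
    using d poset_on_dual[of p P] by (auto simp: legs_def poset_on_def)
  have T: "T1 \<in> P" "T2 \<in> P" "G \<subseteq> T1" "G \<subseteq> T2"
    using d mem_dual_iff[OF P] U by (auto simp: legs_def T1_def T2_def G_def)
  have inc: "\<not> T1 \<subseteq> T2" "\<not> T2 \<subseteq> T1"
    using d U by (auto simp: legs_def T1_def T2_def)
  have below: "A \<subseteq> G" if A: "A \<in> P" "A \<noteq> T1" "A \<noteq> T2" for A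
  proof -
    have "A \<subseteq> {1..p}" using A P by (auto simp: poset_on_def)
    then have "{1..p} - A \<in> dual_poset p P - {U1, U2}"
      using A U by (auto simp: dual_poset_def T1_def T2_def double_diff)
    then have "K \<subseteq> {1..p} - A" using d by (auto simp: legs_def)
    then show ?thesis using \<open>A \<subseteq> {1..p}\<close> by (auto simp: G_def)
  qed
  have L: "H \<in> P" "L1 \<subseteq> H" "L2 \<subseteq> H" "\<not> H \<subseteq> L1" "\<not> H \<subseteq> L2" and up: "\<And>A. A \<in> P - {L1, L2} \<Longrightarrow> H \<subseteq> A"
    using l by (auto simp: legs_def)
  \<comment> \<open>\<open>H\<close> is comparable with every element of \<open>P\<close>, so it is
    neither \<open>T1\<close> nor \<open>T2\<close> and lies below \<open>G\<close>.\<close>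
  have "H \<subseteq> T1" "H \<subseteq> T2"
    using below[OF L(1)] T L up inc by blast+
  then have "T1 \<in> P - {L1, L2}" "T2 \<in> P - {L1, L2}" using T L by auto
  then show ?thesis using inc by (auto simp: chain_subset_def)
qed

lemma not_chain_subset_induced:
  assumes "induced_subposet P Q" "\<not> chain_subset P"
  shows "\<not> chain_subset Q"
proof -
  obtain \<phi> where \<phi>: "\<And>A. A \<in> P \<Longrightarrow> \<phi> A \<in> Q"
    "\<And>A B. A \<in> P \<Longrightarrow> B \<in> P \<Longrightarrow> \<phi> A \<subseteq> \<phi> B \<longleftrightarrow> A \<subseteq> B"
    using assms(1) by (rule induced_subposetE) blast
  obtain A B where AB: "A \<in> P" "B \<in> P" "\<not> A \<subseteq> B" "\<not> B \<subseteq> A"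
    using assms(2) unfolding chain_subset_def by blast
  then have "\<not> \<phi> A \<subseteq> \<phi> B" "\<not> \<phi> B \<subseteq> \<phi> A" by (simp_all add: \<phi>(2))
  moreover have "\<phi> A \<in> Q" "\<phi> B \<in> Q" using AB \<phi>(1) by auto
  ultimately show ?thesis unfolding chain_subset_def by blast
qed

text \<open>Restates the condition above \<open>A\<close> through chains instead of copies of
  \<open>P\<close>, so that it can be compared with the family obtained from the dual.\<close>

lemma saturated_lower_family_if_dual_legs:
  assumes "induced_saturated n P \<F>" "poset_on p P" "has_legs P" "has_legs (dual_poset p P)"
  obtains \<L> where "\<L> \<subseteq> \<F>" "n + 1 \<le> card \<L>"
    "\<And>A. A \<in> \<L> \<Longrightarrow> chain_subset {B \<in> \<F>. B \<subseteq> A}"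
    "\<And>A. A \<in> \<L> \<Longrightarrow> chain_subset {B \<in> \<F>. A \<subseteq> B} \<Longrightarrow> card A \<le> 1"
proof -
  obtain L1 L2 H where l: "legs P L1 L2 H" using assms by (auto simp: has_legs_iff)
  have above: "\<not> chain_subset {B \<in> \<F>. A \<subseteq> B}" if "induced_subposet (P - {L1, L2}) {B \<in> \<F>. A \<subseteq> B}" for A
    using that not_chain_without_legs[OF assms(2) l assms(4)] by (rule not_chain_subset_induced)
  obtain \<L> where L: "\<L> \<subseteq> \<F>" "n + 1 \<le> card \<L>"
    "\<And>A. A \<in> \<L> \<Longrightarrow> chain_subset {B \<in> \<F>. B \<subseteq> A}"
    "\<And>A. A \<in> \<L> \<Longrightarrow> card A \<le> 1 \<or> induced_subposet (P - {L1, L2}) {B \<in> \<F>. A \<subseteq> B}"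
    using saturated_lower_family[OF assms(1) l] by blast
  show thesis
  proof (rule that[OF L(1-3)])
    show "card A \<le> 1" if "A \<in> \<L>" "chain_subset {B \<in> \<F>. A \<subseteq> B}" for A
      using L(4)[OF that(1)] above[of A] that(2) by blast
  qed
qed

lemma chain_subset_dual_iff:
  assumes "poset_on n \<F>"
  shows "chain_subset (dual_poset n \<F>) \<longleftrightarrow> chain_subset \<F>"
proof -
  have "{1..n} - A \<subseteq> {1..n} - B \<longleftrightarrow> B \<subseteq> A" if "B \<in> \<F>" for A B
    using that assms by (auto simp: poset_on_def)
  then have "chain_subset (dual_poset n \<F>) \<longleftrightarrow> (\<forall>A\<in>\<F>. \<forall>B\<in>\<F>. B \<subseteq> A \<or> A \<subseteq> B)"
    by (simp add: chain_subset_def dual_poset_def)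
  also have "\<dots> \<longleftrightarrow> chain_subset \<F>" unfolding chain_subset_def by blast
  finally show ?thesis .
qed

lemma chain_above_iff_dual_chain_below:
  assumes F: "poset_on n \<F>" and A: "A \<subseteq> {1..n}"
  shows "chain_subset {B \<in> dual_poset n \<F>. B \<subseteq> {1..n} - A} \<longleftrightarrow> chain_subset {B \<in> \<F>. A \<subseteq> B}"
proof -
  have "{B \<in> dual_poset n \<F>. B \<subseteq> {1..n} - A} = dual_poset n {B \<in> \<F>. A \<subseteq> B}"
    using A by (auto simp: dual_poset_def)
  moreover have "poset_on n {B \<in> \<F>. A \<subseteq> B}" using F by (auto simp: poset_on_def)
  ultimately show ?thesis by (simp add: chain_subset_dual_iff)
qed

lemma chain_below_iff_dual_chain_above:
  assumes F: "poset_on n \<F>" and A: "A \<subseteq> {1..n}"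
  shows "chain_subset {B \<in> dual_poset n \<F>. {1..n} - A \<subseteq> B} \<longleftrightarrow> chain_subset {B \<in> \<F>. B \<subseteq> A}"
proof -
  have "{B \<in> dual_poset n \<F>. {1..n} - A \<subseteq> B} = dual_poset n {B \<in> \<F>. B \<subseteq> A}"
    using F by (auto simp: dual_poset_def poset_on_def)
  moreover have "poset_on n {B \<in> \<F>. B \<subseteq> A}" using F by (auto simp: poset_on_def)
  ultimately show ?thesis by (simp add: chain_subset_dual_iff)
qed

lemma card_saturated_both_legs:
  assumes n: "n \<ge> 3" and sat: "induced_saturated n P \<F>" and P: "poset_on p P"
    and l: "has_legs P" and dl: "has_legs (dual_poset p P)"
  shows "2 * n + 2 \<le> card \<F>"
proof -
  let ?c = "\<lambda>A. {1..n} - A"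
  have F: "poset_on n \<F>" using sat by (auto simp: induced_saturated_def poset_on_def)
  obtain \<L> where L: "\<L> \<subseteq> \<F>" "n + 1 \<le> card \<L>"
    "\<And>A. A \<in> \<L> \<Longrightarrow> chain_subset {B \<in> \<F>. B \<subseteq> A}"
    "\<And>A. A \<in> \<L> \<Longrightarrow> chain_subset {B \<in> \<F>. A \<subseteq> B} \<Longrightarrow> card A \<le> 1"
    using saturated_lower_family_if_dual_legs[OF sat P l dl] by blast
  have ddl: "has_legs (dual_poset p (dual_poset p P))" using l dual_dual[OF P] by simp
  obtain \<U> where U: "\<U> \<subseteq> dual_poset n \<F>" "n + 1 \<le> card \<U>"
    "\<And>A. A \<in> \<U> \<Longrightarrow> chain_subset {B \<in> dual_poset n \<F>. B \<subseteq> A}"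
    "\<And>A. A \<in> \<U> \<Longrightarrow> chain_subset {B \<in> dual_poset n \<F>. A \<subseteq> B} \<Longrightarrow> card A \<le> 1"
    using saturated_lower_family_if_dual_legs[OF induced_saturated_dual[OF P sat] poset_on_dual dl ddl]
    by blast
  have sub: "A \<subseteq> {1..n}" if "A \<in> \<L> \<or> A \<in> \<U>" for A
    using that L(1) U(1) F by (auto simp: poset_on_def dual_poset_def)
  have inj: "inj_on ?c \<U>" by (rule inj_onI) (metis double_diff order_refl sub)
  have "dual_poset n \<U> \<subseteq> dual_poset n (dual_poset n \<F>)"
    unfolding dual_poset_def[of n \<U>] dual_poset_def[of n "dual_poset n \<F>"] using U(1) by (rule image_mono)
  then have "dual_poset n \<U> \<subseteq> \<F>" by (simp add: dual_dual[OF F])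
  moreover have "\<L> \<inter> dual_poset n \<U> = {}"
  proof (rule ccontr)
    assume "\<L> \<inter> dual_poset n \<U> \<noteq> {}"
    then obtain A where A: "A \<in> \<L>" "A \<in> dual_poset n \<U>" by blast
    then have An: "A \<subseteq> {1..n}" and cA: "?c A \<in> \<U>"
      using sub by (auto simp: dual_poset_def double_diff)
    \<comment> \<open>\<open>\<F>\<close> is a chain below \<open>A\<close> because
      \<open>A \<in> \<L>\<close>, and above \<open>A\<close> because
      \<open>?c A \<in> \<U>\<close>. So \<open>A\<close> and its complement have at most one
      element each, which would give \<open>n \<le> 2\<close>.\<close>
    have "card A \<le> 1" using L(4)[OF A(1)] U(3)[OF cA] chain_above_iff_dual_chain_below[OF F An] by blast
    moreover have "card (?c A) \<le> 1"
      using U(4)[OF cA] L(3)[OF A(1)] chain_below_iff_dual_chain_above[OF F An] by blast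
    moreover have "card (?c A) = n - card A"
      using An by (simp add: card_Diff_subset finite_subset)
    ultimately show False using n by linarith
  qed
  moreover have "finite \<F>" using F finite_subset by (fastforce simp: poset_on_def)
  moreover have "card (dual_poset n \<U>) = card \<U>"
    using inj by (simp add: dual_poset_def card_image)
  ultimately have "card \<L> + card \<U> \<le> card \<F>"
    using L(1) by (metis card_Un_disjoint card_mono finite_subset Un_least)
  then show ?thesis using L(2) U(2) by linarith
qed

theorem theorem1p5:
  fixes P :: "nat set set" and n :: nat
  assumes "set_poset P"
    and "has_legs P"
    and "n \<ge> 3"
  shows "sat_star n P \<ge> n + 1
    \<and> (\<forall>p. poset_on p P \<and> has_legs (dual_poset p P) \<longrightarrow> sat_star n P \<ge> 2 * n + 2)"
proof -
  obtain L1 L2 H where l: "legs P L1 L2 H" using assms by (auto simp: has_legs_iff)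
  then have "P \<noteq> {}" by (auto simp: legs_def)
  then have "\<exists>m \<F>. induced_saturated n P \<F> \<and> card \<F> = m"
    using induced_saturated_exists by blast
  \<comment> \<open>As \<open>P\<close> is nonempty, the minimum is attained, and bounds valid for
    every saturated family carry over to \<open>sat_star\<close>.\<close>
  then have "\<exists>\<F>. induced_saturated n P \<F> \<and> card \<F> = sat_star n P"
    unfolding sat_star_def by (rule LeastI_ex)
  then obtain \<F> where sat: "induced_saturated n P \<F>" and card: "card \<F> = sat_star n P"
    by blast
  have "finite \<F>" using sat finite_subset by (fastforce simp: induced_saturated_def)
  then have "n + 1 \<le> card \<F>"
    using saturated_lower_family[OF sat l] by (metis card_mono order_trans)
  then show ?thesis
    using card_saturated_both_legs[OF assms(3) sat _ assms(2)] card by auto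
qed

end
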